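(* Let $d\ge 1$ and let $\mathcal{F}_1,\mathcal{F}_2,\ldots$ be an infinite sequence of families of compact convex sets in $\mathbb{R}^d$. If every infinite heterochromatic sequence of convex sets contains $d+1$ intersecting sets, then there exists an $\mathcal{F}_i$ which can be pierced by finitely many points.
   Context: For a sequence $\mathcal{F}_1,\mathcal{F}_2,\ldots$ of families, an infinite sequence of elements $C_1,C_2,\ldots$ is heterochromatic if there exist indices $i_1<i_2<\ldots$ with $C_j\in\mathcal{F}_{i_j}$ for all $j$. Such a sequence contains $d+1$ intersecting sets if some $d+1$ of its terms (with distinct indices) have a point in common. A family $\mathcal{F}_i$ can be pierced by finitely many points if there is a finite set of points in $\mathbb{R}^d$ meeting every member of $\mathcal{F}_i$. *)

theory Defs
  imports "HOL-Analysis.Analysis"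
begin

definition heterochromatic :: "(nat \<Rightarrow> 'a set) \<Rightarrow> (nat \<Rightarrow> 'a) \<Rightarrow> bool" where
  "heterochromatic F C \<longleftrightarrow> (\<exists>i :: nat \<Rightarrow> nat. strict_mono i \<and> (\<forall>j. C j \<in> F (i j)))"

text \<open>The terms are counted by their indices, so a set that occurs several times in the
  sequence counts with multiplicity.\<close>

definition contains_intersecting :: "nat \<Rightarrow> (nat \<Rightarrow> 'a set) \<Rightarrow> bool" where
  "contains_intersecting k C \<longleftrightarrow>
     (\<exists>J. finite J \<and> card J = k \<and> (\<exists>x. \<forall>j\<in>J. x \<in> C j))"

definition finitely_pierceable :: "'a set set \<Rightarrow> bool" where
  "finitely_pierceable \<F> \<longleftrightarrow> (\<exists>P. finite P \<and> (\<forall>A\<in>\<F>. P \<inter> A \<noteq> {}))"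

end

theory Submission
  imports Defs
begin

text \<open>
  Assume that no family is finitely pierceable. Then some ultrafilter on the pairs
  \<open>(i, A)\<close> with \<open>A \<in> F i\<close> contains \<open>{(i, A). n < i}\<close> for every \<open>n\<close> and
  \<open>{(i, A). x \<notin> A}\<close> for every point \<open>x\<close>.
  For an affine subspace \<open>V\<close>, let \<open>L\<close> be the set of the points of \<open>V\<close> each neighbourhood
  of which meets \<open>A \<inter> V\<close> for almost all \<open>A\<close>. If \<open>L\<close> affinely spanned \<open>V \<noteq> {}\<close>, then by convexity
  almost all \<open>A\<close> would contain a common point, namely any relative interior point of a simplex
  with vertices in \<open>L\<close>. Hence \<open>V' = affine hull L\<close> has smaller dimension than \<open>V\<close>, and a compact
  set \<open>K\<close> disjoint from \<open>V'\<close> is disjoint from \<open>A \<inter> V\<close> for almost all \<open>A\<close>. Iterating from the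
  whole space gives a chain \<open>V 0 \<subseteq> \<dots> \<subseteq> V d\<close> with \<open>V 0\<close> at most a point, and one can
  choose sets one at a time so that any \<open>j + 1\<close> of them have no common point in \<open>V j\<close>.
\<close>

section \<open>Ultrafilters\<close>

text \<open>Zorn's lemma gives a maximal family \<open>M\<close> above \<open>\<B>\<close> with the
  finite intersection property. This property makes the filter generated by \<open>M\<close> proper,
  and maximality makes it decide every predicate.\<close>

lemma ultrafilter_of_fip:
  fixes \<B> :: "'a set set"
  assumes fip: "\<And>Y. finite Y \<Longrightarrow> Y \<subseteq> \<B> \<Longrightarrow> \<Inter>Y \<noteq> {}"
  obtains U where "U \<noteq> bot" "\<And>B. B \<in> \<B> \<Longrightarrow> \<forall>\<^sub>F x in U. x \<in> B"
    "\<And>P. (\<forall>\<^sub>F x in U. P x) \<or> (\<forall>\<^sub>F x in U. \<not> P x)"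
proof -
  define X where "X = {M. \<B> \<subseteq> M \<and> (\<forall>Y. finite Y \<longrightarrow> Y \<subseteq> M \<longrightarrow> \<Inter>Y \<noteq> {})}"
  have "\<exists>M\<in>X. \<forall>N\<in>X. M \<subseteq> N \<longrightarrow> N = M"
  proof (rule subset_Zorn_nonempty)
    show "X \<noteq> {}"
      using fip by (auto simp: X_def)
    fix \<C> assume "\<C> \<noteq> {}" and chain: "subset.chain X \<C>"
    then have "\<C> \<subseteq> X"
      by (simp add: subset_chain_def)
    have "\<Inter>Y \<noteq> {}" if Y: "finite Y" "Y \<subseteq> \<Union>\<C>" for Y
    proof -
      obtain C where "C \<in> \<C>" "Y \<subseteq> C"
        using finite_subset_Union_chain[OF Y \<open>\<C> \<noteq> {}\<close> chain] .
      then show ?thesis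
        using \<open>\<C> \<subseteq> X\<close> Y by (auto simp: X_def)
    qed
    moreover obtain C where "C \<in> \<C>"
      using \<open>\<C> \<noteq> {}\<close> by blast
    then have "\<B> \<subseteq> \<Union>\<C>"
      using \<open>\<C> \<subseteq> X\<close> by (auto simp: X_def)
    ultimately show "\<Union>\<C> \<in> X"
      by (simp add: X_def)
  qed
  then obtain M where M: "M \<in> X" and max: "\<And>N. N \<in> X \<Longrightarrow> M \<subseteq> N \<Longrightarrow> N = M"
    by blast
  have \<B>_M: "\<B> \<subseteq> M" and fip_M: "\<And>Y. finite Y \<Longrightarrow> Y \<subseteq> M \<Longrightarrow> \<Inter>Y \<noteq> {}"
    using M by (simp_all add: X_def)
  define U where "U = (INF S\<in>M. principal S)"
  have ev: "\<forall>\<^sub>F x in U. x \<in> S" if "S \<in> M" for S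
    unfolding U_def by (rule eventually_INF1[OF that]) (simp add: eventually_principal)
  have extend: "\<exists>Y. finite Y \<and> Y \<subseteq> M \<and> S \<inter> \<Inter>Y = {}" if "S \<notin> M" for S
  proof -
    have "insert S M \<notin> X"
      using max[of "insert S M"] that by blast
    then obtain Y where Y: "finite Y" "Y \<subseteq> insert S M" "\<Inter>Y = {}"
      using \<B>_M by (auto simp: X_def)
    show ?thesis
      by (rule exI[of _ "Y - {S}"]) (use Y in auto)
  qed
  show ?thesis
  proof
    show "U \<noteq> bot"
      unfolding U_def
    proof (rule INF_filter_not_bot)
      fix Y assume "Y \<subseteq> M" "finite Y"
      then show "(INF S\<in>Y. principal S) \<noteq> bot"
        using fip_M by (simp add: INF_principal_finite principal_eq_bot_iff)
    qed
    show "\<forall>\<^sub>F x in U. x \<in> B" if "B \<in> \<B>" for B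
      using \<B>_M that by (intro ev) auto
    show "(\<forall>\<^sub>F x in U. P x) \<or> (\<forall>\<^sub>F x in U. \<not> P x)" for P
    proof -
      have "Collect P \<in> M \<or> - Collect P \<in> M"
      proof (rule ccontr)
        assume "\<not> ?thesis"
        then obtain Y Z where "finite Y" "Y \<subseteq> M" "Collect P \<inter> \<Inter>Y = {}"
          and "finite Z" "Z \<subseteq> M" "- Collect P \<inter> \<Inter>Z = {}"
          using extend by meson
        then have "finite (Y \<union> Z)" "Y \<union> Z \<subseteq> M" "\<Inter>(Y \<union> Z) = {}"
          by (simp, simp, blast)
        then show False
          using fip_M by blast
      qed
      then show ?thesis
        using ev by fastforce
    qed
  qed
qed

section \<open>Limits of convex sets along an ultrafilter\<close>

text \<open>If \<open>x\<close> were outside \<open>C\<close>, moving from \<open>x\<close> by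
  \<open>e\<close> directly away from the closest point \<open>c\<close> would reach a point
  \<open>z\<close> still in \<open>convex hull S\<close>. But \<open>S\<close> lies within
  \<open>e\<close> of \<open>C\<close>, hence strictly on the \<open>c\<close> side of the
  hyperplane through \<open>z\<close> orthogonal to \<open>a\<close>.\<close>

lemma mem_convex_if_near_simplex:
  fixes x :: "'a::euclidean_space"
  assumes C: "convex C" "closed C" "C \<subseteq> affine hull S"
    and S: "S \<noteq> {}" and x: "x \<in> affine hull S"
    and ball: "cball x e \<inter> affine hull S \<subseteq> convex hull S" and "e > 0"
    and near: "\<And>s. s \<in> S \<Longrightarrow> \<exists>y\<in>C. dist y s < e"
  shows "x \<in> C"
proof (rule ccontr)
  assume "x \<notin> C"
  have "C \<noteq> {}"
    using S near by blast
  define c where "c = closest_point C x"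
  have "c \<in> C"
    unfolding c_def using C \<open>C \<noteq> {}\<close> by (simp add: closest_point_in_set)
  define a where "a = c - x"
  have "a \<noteq> 0"
    using \<open>c \<in> C\<close> \<open>x \<notin> C\<close> by (auto simp: a_def)
  have C_side: "a \<bullet> c \<le> a \<bullet> y" if "y \<in> C" for y
    using closest_point_dot[OF C(1,2) that, of x]
    by (simp add: a_def c_def algebra_simps inner_diff_left inner_diff_right)
  define t where "t = - (e / norm a)"
  define z where "z = x + t *\<^sub>R a"
  have "z = (1 - t) *\<^sub>R x + t *\<^sub>R c"
    by (simp add: z_def a_def algebra_simps)
  then have "z \<in> affine hull S"
    using C(3) \<open>c \<in> C\<close> x by (auto intro: mem_affine[OF affine_affine_hull])
  moreover have "dist x z = e"
    using \<open>a \<noteq> 0\<close> \<open>e > 0\<close> by (simp add: z_def t_def dist_norm)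
  ultimately have "z \<in> convex hull S"
    using ball by auto
  have az: "a \<bullet> z = a \<bullet> x - norm a * e"
    using \<open>a \<noteq> 0\<close>
    by (simp add: z_def t_def inner_diff_right power2_norm_eq_inner[symmetric] power2_eq_square)
  have "S \<subseteq> {w. a \<bullet> w > a \<bullet> x - norm a * e}"
  proof
    fix s assume "s \<in> S"
    then obtain y where y: "y \<in> C" "dist y s < e"
      using near by blast
    have "a \<bullet> (y - s) \<le> norm a * norm (y - s)"
      by (rule norm_cauchy_schwarz)
    also have "\<dots> < norm a * e"
      using y \<open>a \<noteq> 0\<close> by (simp add: dist_norm)
    finally have "a \<bullet> s > a \<bullet> y - norm a * e"
      by (simp add: inner_diff_right)
    moreover have "a \<bullet> x \<le> a \<bullet> c"
      using inner_ge_zero[of a] by (simp add: a_def inner_diff_right)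
    ultimately show "s \<in> {w. a \<bullet> w > a \<bullet> x - norm a * e}"
      using C_side[OF y(1)] by simp
  qed
  then have "convex hull S \<subseteq> {w. a \<bullet> w > a \<bullet> x - norm a * e}"
    by (rule hull_minimal) (rule convex_halfspace_gt)
  with \<open>z \<in> convex hull S\<close> az show False
    by auto
qed

text \<open>Compactness and convexity are asked for almost all indices only, since the type of all
  pairs \<open>(i, A)\<close> also has pairs with \<open>A \<notin> F i\<close>.\<close>

locale avoiding_ultrafilter =
  fixes U :: "'i filter" and A :: "'i \<Rightarrow> 'a::euclidean_space set"
  assumes proper: "U \<noteq> bot"
    and ultra: "(\<forall>\<^sub>F i in U. P i) \<or> (\<forall>\<^sub>F i in U. \<not> P i)"
    and compact_convex: "\<forall>\<^sub>F i in U. compact (A i) \<and> convex (A i)"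
    and avoids: "\<forall>\<^sub>F i in U. x \<notin> A i"
begin

text \<open>The drop in dimension comes from \<open>avoids\<close>, the last conclusion from
  covering \<open>K\<close> by finitely many open sets, each of which misses
  \<open>A i \<inter> V\<close> for almost all \<open>i\<close>.\<close>

lemma lower_dim_limit:
  assumes V: "affine V" "V \<noteq> {}"
  obtains V' where "affine V'" "aff_dim V' < aff_dim V"
    "\<And>K. compact K \<Longrightarrow> K \<inter> V' = {} \<Longrightarrow> \<forall>\<^sub>F i in U. K \<inter> A i \<inter> V = {}"
proof -
  define L where "L = {x \<in> V. \<forall>N. open N \<longrightarrow> x \<in> N \<longrightarrow> (\<forall>\<^sub>F i in U. N \<inter> A i \<inter> V \<noteq> {})}"
  have "L \<subseteq> V"
    by (auto simp: L_def)
  then have hull_L: "affine hull L \<subseteq> V"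
    using V by (simp add: hull_minimal)
  have "affine hull L \<noteq> V"
  proof
    assume hull: "affine hull L = V"
    \<comment> \<open>An affine basis is finite, so almost every single \<open>A i\<close> comes
      close to all of its points at once.\<close>
    obtain S where S: "S \<subseteq> L" "\<not> affine_dependent S" "affine hull L = affine hull S"
      using affine_basis_exists by blast
    then have hull_S: "affine hull S = V" and "finite S"
      using hull by (auto intro: aff_independent_finite)
    then have "S \<noteq> {}"
      using V by auto
    then obtain x where "x \<in> rel_interior (convex hull S)"
      using rel_interior_eq_empty[of "convex hull S"] by auto
    then obtain e where e: "x \<in> convex hull S" "e > 0"
      "cball x e \<inter> affine hull S \<subseteq> convex hull S"
      by (auto simp: mem_rel_interior_cball affine_hull_convex_hull)
    have "\<forall>\<^sub>F i in U. \<forall>s\<in>S. ball s e \<inter> A i \<inter> V \<noteq> {}"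
      using \<open>finite S\<close> S(1) e(2) by (auto simp: eventually_ball_finite_distrib L_def)
    then have "\<forall>\<^sub>F i in U. x \<in> A i"
      using compact_convex
    proof eventually_elim
      case (elim i)
      have "x \<in> A i \<inter> V"
      proof (rule mem_convex_if_near_simplex)
        show "convex (A i \<inter> V)"
          using elim V by (simp add: convex_Int affine_imp_convex)
        show "closed (A i \<inter> V)"
          using elim V by (simp add: closed_Int compact_imp_closed affine_closed)
        show "x \<in> affine hull S"
          using e(1) convex_hull_subset_affine_hull by blast
        show "\<exists>y\<in>A i \<inter> V. dist y s < e" if "s \<in> S" for s
          using elim that by (fastforce simp: dist_commute)
      qed (use hull_S \<open>S \<noteq> {}\<close> e in auto)
      then show ?case
        by simp
    qed
    then have "\<forall>\<^sub>F i in U. False"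
      using avoids[of x] by eventually_elim simp
    then show False
      using proper by simp
  qed
  show ?thesis
  proof
    show "affine (affine hull L)"
      by (rule affine_affine_hull)
    show "aff_dim (affine hull L) < aff_dim V"
      using hull_L \<open>affine hull L \<noteq> V\<close> V by (intro aff_dim_psubset) (auto simp: hull_same)
    fix K :: "'a set" assume K: "compact K" "K \<inter> affine hull L = {}"
    have "\<exists>N. open N \<and> x \<in> N \<and> (\<forall>\<^sub>F i in U. N \<inter> A i \<inter> V = {})" if "x \<in> K" for x
    proof (cases "x \<in> V")
      case True
      moreover have "x \<notin> L"
        using that K by (auto dest: hull_inc)
      ultimately obtain N where N: "open N" "x \<in> N" "\<not> (\<forall>\<^sub>F i in U. N \<inter> A i \<inter> V \<noteq> {})"
        by (auto simp: L_def)
      then have "\<forall>\<^sub>F i in U. N \<inter> A i \<inter> V = {}"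
        using ultra[of "\<lambda>i. N \<inter> A i \<inter> V = {}"] by simp
      with N show ?thesis
        by blast
    next
      case False
      then show ?thesis
        using V by (intro exI[of _ "- V"]) (auto simp: affine_closed open_Compl Int_assoc)
    qed
    then obtain N where N: "\<And>x. x \<in> K \<Longrightarrow> open (N x)" "\<And>x. x \<in> K \<Longrightarrow> x \<in> N x"
      "\<And>x. x \<in> K \<Longrightarrow> \<forall>\<^sub>F i in U. N x \<inter> A i \<inter> V = {}"
      by metis
    obtain D where D: "D \<subseteq> K" "finite D" "K \<subseteq> (\<Union>x\<in>D. N x)"
      by (rule compactE_image[OF K(1), of K N]) (use N in auto)
    have "\<forall>\<^sub>F i in U. \<forall>x\<in>D. N x \<inter> A i \<inter> V = {}"
      using D N(3) by (auto simp: eventually_ball_finite_distrib)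
    then show "\<forall>\<^sub>F i in U. K \<inter> A i \<inter> V = {}"
      by eventually_elim (use D(3) in blast)
  qed
qed

text \<open>Iterates \<open>lower_dim_limit\<close> from the top, \<open>V'\<close> becoming the
  level just below \<open>V\<close>. The bottom level has at most one point, which almost all
  \<open>A i\<close> avoid.\<close>

lemma limit_chain:
  assumes "affine V" "aff_dim V \<le> int n"
  obtains W where "W n = V" "\<forall>\<^sub>F i in U. A i \<inter> W 0 = {}"
    "\<And>K j. j < n \<Longrightarrow> compact K \<Longrightarrow> K \<inter> W j = {} \<Longrightarrow> \<forall>\<^sub>F i in U. K \<inter> A i \<inter> W (Suc j) = {}"
  using assms
proof (induction n arbitrary: V thesis)
  case 0
  have "\<exists>x. V \<subseteq> {x}"
  proof (cases "V = {}")
    case False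
    then have "aff_dim V \<noteq> -1"
      by (simp add: aff_dim_empty)
    then have "aff_dim V = 0"
      using 0(3) aff_dim_geq[of V] by simp
    then show ?thesis
      by (auto simp: aff_dim_eq_0)
  qed simp
  then obtain x where "V \<subseteq> {x}"
    by blast
  then have "\<forall>\<^sub>F i in U. A i \<inter> V = {}"
    using avoids[of x] by (auto elim: eventually_mono)
  then show ?case
    by (intro 0(1)[of "\<lambda>_. V"]) auto
next
  case (Suc n)
  obtain V' where V': "affine V'" "aff_dim V' \<le> int n"
    "\<And>K. compact K \<Longrightarrow> K \<inter> V' = {} \<Longrightarrow> \<forall>\<^sub>F i in U. K \<inter> A i \<inter> V = {}"
  proof (cases "V = {}")
    case True
    then show ?thesis
      \<comment> \<open>The dimension of the empty set cannot drop, but the chain may stay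
        empty.\<close>
      by (intro that[of "{}"]) auto
  next
    case False
    then obtain V' where "affine V'" "aff_dim V' < aff_dim V"
      "\<And>K. compact K \<Longrightarrow> K \<inter> V' = {} \<Longrightarrow> \<forall>\<^sub>F i in U. K \<inter> A i \<inter> V = {}"
      using lower_dim_limit Suc.prems(2) by metis
    then show ?thesis
      using Suc.prems(3) by (intro that[of V']) auto
  qed
  obtain W where W: "W n = V'" "\<forall>\<^sub>F i in U. A i \<inter> W 0 = {}"
    "\<And>K j. j < n \<Longrightarrow> compact K \<Longrightarrow> K \<inter> W j = {} \<Longrightarrow> \<forall>\<^sub>F i in U. K \<inter> A i \<inter> W (Suc j) = {}"
    using Suc.IH[OF _ V'(1,2)] by blast
  show ?case
  proof (rule Suc.prems(1)[of "W(Suc n := V)"])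
    fix K :: "'a set" and j
    assume "j < Suc n" "compact K" "K \<inter> (W(Suc n := V)) j = {}"
    then show "\<forall>\<^sub>F i in U. K \<inter> A i \<inter> (W(Suc n := V)) (Suc j) = {}"
      using W V'(3) by (cases "j = n") auto
  qed (use W in auto)
qed

text \<open>Greedy choice: almost all indices are compatible with the finitely many earlier ones.
  \<open>R\<close> and \<open>Q\<close> will stand for growing family indices and membership in the
  families.\<close>

lemma sparse_sequence:
  assumes R: "\<And>i. \<forall>\<^sub>F i' in U. R i i'" and Q: "\<forall>\<^sub>F i in U. Q i"
  obtains f :: "nat \<Rightarrow> 'i" where "\<And>m n. m < n \<Longrightarrow> R (f m) (f n)" "\<And>n. Q (f n)"
    "\<And>J. finite J \<Longrightarrow> card J = DIM('a) + 1 \<Longrightarrow> (\<Inter>n\<in>J. A (f n)) = {}"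
proof -
  let ?d = "DIM('a)"
  obtain W where W_top: "W ?d = (UNIV :: 'a set)" and W_0: "\<forall>\<^sub>F i in U. A i \<inter> W 0 = {}"
    and W_Suc: "\<And>K j. j < ?d \<Longrightarrow> compact K \<Longrightarrow> K \<inter> W j = {} \<Longrightarrow>
      \<forall>\<^sub>F i in U. K \<inter> A i \<inter> W (Suc j) = {}"
    using limit_chain[of UNIV ?d] by auto
  \<comment> \<open>\<open>r\<close> is admissible as term \<open>n\<close> after the earlier terms
    of \<open>f\<close>. Together with \<open>card J\<close> earlier sets, \<open>A r\<close> makes
    \<open>card J + 1\<close> sets, which must have no common point in level \<open>card J\<close>;
    for \<open>J = {}\<close> this says that \<open>A r\<close> misses \<open>W 0\<close>.\<close>
  define G where "G f n r \<longleftrightarrow> Q r \<and> compact (A r) \<and> (\<forall>m<n. R (f m) r) \<and>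
    (\<forall>J. J \<subseteq> {..<n} \<longrightarrow> card J \<le> ?d \<longrightarrow> (\<Inter>m\<in>J. A (f m)) \<inter> A r \<inter> W (card J) = {})"
    for f :: "nat \<Rightarrow> 'i" and n :: nat and r
  \<comment> \<open>The largest index in \<open>J\<close> was chosen last, so its admissibility
    applies to the rest of \<open>J\<close>.\<close>
  have sparse: "(\<Inter>m\<in>J. A (f m)) \<inter> W j = {}"
    if G: "\<And>m. m < n \<Longrightarrow> G f m (f m)" and J: "J \<subseteq> {..<n}" "card J = Suc j" "j \<le> ?d"
    for f n J j
  proof -
    have "finite J" "J \<noteq> {}"
      using J finite_subset by auto
    define m where "m = Max J"
    have m: "m \<in> J"
      unfolding m_def using \<open>finite J\<close> \<open>J \<noteq> {}\<close> by simp
    have "J - {m} \<subseteq> {..<m}"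
      using \<open>finite J\<close> Max_ge[of J] unfolding m_def by (force simp: order_less_le)
    moreover have "card (J - {m}) = j"
      using m J by simp
    ultimately have "(\<Inter>k\<in>J - {m}. A (f k)) \<inter> A (f m) \<inter> W j = {}"
      using G[of m] m J unfolding G_def by blast
    moreover have "(\<Inter>k\<in>J. A (f k)) = (\<Inter>k\<in>J - {m}. A (f k)) \<inter> A (f m)"
      using m by blast
    ultimately show ?thesis
      by simp
  qed
  have "\<exists>f. \<forall>n. G f n (f n)"
  proof (rule dependent_wellorder_choice)
    \<comment> \<open>\<open>G f n\<close> looks at \<open>f\<close> only below \<open>n\<close>, as
      the recursion requires.\<close>
    fix r and f g :: "nat \<Rightarrow> 'i" and n assume "\<And>m. m < n \<Longrightarrow> f m = g m"
    then have "(\<forall>m<n. R (f m) r) = (\<forall>m<n. R (g m) r)"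
      and "\<And>J. J \<subseteq> {..<n} \<Longrightarrow> (\<Inter>m\<in>J. A (f m)) = (\<Inter>m\<in>J. A (g m))"
      by (auto simp: subset_iff)
    then show "G f n r = G g n r"
      unfolding G_def by (metis (no_types, lifting))
  next
    fix n and f :: "nat \<Rightarrow> 'i" assume G: "\<And>m. m < n \<Longrightarrow> G f m (f m)"
    have "\<forall>\<^sub>F r in U. card J \<le> ?d \<longrightarrow> (\<Inter>m\<in>J. A (f m)) \<inter> A r \<inter> W (card J) = {}"
      if J: "J \<in> Pow {..<n}" for J
    \<comment> \<open>The empty intersection is the whole space and not compact, so
      \<open>J = {}\<close> rests on \<open>W_0\<close>. Otherwise the \<open>Suc j\<close> earlier
      sets meet in a compact set that misses \<open>W j\<close> by \<open>sparse\<close>, and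
      \<open>W_Suc\<close> applies.\<close>
    proof (cases "card J")
      case 0
      moreover have "finite J"
        using J finite_subset[of J "{..<n}"] by simp
      ultimately have "J = {}"
        by simp
      then show ?thesis
        using W_0 by simp
    next
      case (Suc j)
      then have "J \<noteq> {}"
        by auto
      have "compact (\<Inter>m\<in>J. A (f m))"
        using G J \<open>J \<noteq> {}\<close> by (intro compact_Inter) (auto simp: G_def)
      then show ?thesis
        using W_Suc[of j] sparse[OF G, of n J j] J Suc by (cases "j < ?d") auto
    qed
    then have "\<forall>\<^sub>F r in U. \<forall>J\<in>Pow {..<n}. card J \<le> ?d \<longrightarrow>
        (\<Inter>m\<in>J. A (f m)) \<inter> A r \<inter> W (card J) = {}"
      by (intro eventually_ball_finite) auto
    moreover have "\<forall>\<^sub>F r in U. \<forall>m\<in>{..<n}. R (f m) r"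
      by (intro eventually_ball_finite) (auto intro: R)
    ultimately have "\<forall>\<^sub>F r in U. G f n r"
      using Q compact_convex unfolding G_def by eventually_elim auto
    then show "\<exists>r. G f n r"
      using eventually_happens proper by blast
  qed
  then obtain f where f: "\<And>n. G f n (f n)"
    by blast
  show ?thesis
  proof
    show "R (f m) (f n)" if "m < n" for m n
      using f[of n] that by (simp add: G_def)
    show "Q (f n)" for n
      using f[of n] by (simp add: G_def)
    fix J :: "nat set" assume "finite J" "card J = ?d + 1"
    moreover obtain n where "J \<subseteq> {..<n}"
      using \<open>finite J\<close> finite_nat_iff_bounded by blast
    ultimately show "(\<Inter>n\<in>J. A (f n)) = {}"
      using sparse[of n f J ?d] f W_top by simp
  qed
qed

end

section \<open>Ultrafilter on pairs of a family index and a member\<close>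

theorem corollary11:
  fixes F :: "nat \<Rightarrow> (real ^ 'd) set set"
  assumes "\<And>i A. A \<in> F i \<Longrightarrow> compact A \<and> convex A"
    and "\<And>C. heterochromatic F C \<Longrightarrow> contains_intersecting (CARD('d) + 1) C"
  shows "\<exists>i. finitely_pierceable (F i)"
proof (rule ccontr)
  assume "\<not> ?thesis"
  then have avoid: "\<exists>A\<in>F i. P \<inter> A = {}" if "finite P" for i P
    using that unfolding finitely_pierceable_def by blast
  \<comment> \<open>The bound \<open>n\<close> makes family indices grow along the sequence;
    \<open>P\<close> expresses that no finite set pierces a family.\<close>
  define B where "B = (\<lambda>(n, P). {(i, A). n < i \<and> A \<in> F i \<and> P \<inter> A = {}})"
  have fip: "\<Inter>Y \<noteq> {}" if Y: "finite Y" "Y \<subseteq> B ` (UNIV \<times> {P. finite P})" for Y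
  proof -
    obtain Z where Z: "Z \<subseteq> UNIV \<times> {P. finite P}" "finite Z" "Y = B ` Z"
      using finite_subset_image[OF Y] by blast
    \<comment> \<open>\<open>n\<close> exceeds all bounds in \<open>Z\<close>, so \<open>n\<close>
      paired with a member of \<open>F n\<close> avoiding all finite sets in \<open>Z\<close> lies
      in every set of \<open>Y\<close>. \<open>insert 0\<close> covers empty
      \<open>Z\<close>.\<close>
    define n where "n = Suc (Max (insert 0 (fst ` Z)))"
    have n: "fst z < n" if "z \<in> Z" for z
      using Z(2) that by (simp add: n_def less_Suc_eq_le)
    have "finite (\<Union>(snd ` Z))"
      using Z(1,2) by auto
    then obtain A where "A \<in> F n" "\<Union>(snd ` Z) \<inter> A = {}"
      using avoid by blast
    then have "(n, A) \<in> \<Inter>Y"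
      using n Z(3) by (fastforce simp: B_def)
    then show ?thesis
      by blast
  qed
  obtain U where U: "U \<noteq> bot"
    and U_B: "\<And>S. S \<in> B ` (UNIV \<times> {P. finite P}) \<Longrightarrow> \<forall>\<^sub>F x in U. x \<in> S"
    and ultra: "\<And>P. (\<forall>\<^sub>F x in U. P x) \<or> (\<forall>\<^sub>F x in U. \<not> P x)"
    by (rule ultrafilter_of_fip[of "B ` (UNIV \<times> {P. finite P})"]) (rule fip, assumption, assumption, rule that)
  have ev: "\<forall>\<^sub>F p in U. n < fst p \<and> snd p \<in> F (fst p) \<and> P \<inter> snd p = {}" if "finite P" for n P
  proof -
    have "\<forall>\<^sub>F p in U. p \<in> B (n, P)"
      using that by (intro U_B) auto
    then show ?thesis
      by eventually_elim (auto simp: B_def)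
  qed
  interpret avoiding_ultrafilter U snd
  proof
    show "\<forall>\<^sub>F p in U. compact (snd p) \<and> convex (snd p)"
      using ev[of "{}" 0, simplified] by eventually_elim (auto dest: assms(1))
    show "\<forall>\<^sub>F p in U. x \<notin> snd p" for x
      using ev[of "{x}" 0, simplified] by eventually_elim simp
  qed (use U ultra in auto)
  have later: "\<forall>\<^sub>F p' in U. fst p < fst p'" for p
    using ev[of "{}" "fst p", simplified] by eventually_elim simp
  have member: "\<forall>\<^sub>F p in U. snd p \<in> F (fst p)"
    using ev[of "{}" 0, simplified] by eventually_elim simp
  obtain f :: "nat \<Rightarrow> nat \<times> (real ^ 'd) set"
    where f: "\<And>m n. m < n \<Longrightarrow> fst (f m) < fst (f n)" "\<And>n. snd (f n) \<in> F (fst (f n))"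
      "\<And>J. finite J \<Longrightarrow> card J = DIM(real ^ 'd) + 1 \<Longrightarrow> (\<Inter>n\<in>J. snd (f n)) = {}"
    by (rule sparse_sequence[of "\<lambda>p p'. fst p < fst p'" "\<lambda>p. snd p \<in> F (fst p)"])
      (rule later, rule member, rule that)
  have "heterochromatic F (\<lambda>n. snd (f n))"
    unfolding heterochromatic_def
    using f(1,2) by (intro exI[of _ "\<lambda>n. fst (f n)"]) (auto simp: strict_mono_def)
  then obtain J x where "finite J" "card J = CARD('d) + 1" "\<forall>j\<in>J. x \<in> snd (f j)"
    using assms(2) unfolding contains_intersecting_def by blast
  with f(3)[of J] show False
    by auto
qed

end
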